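(* Let $H$ be a connected graph without isolated vertices and let $\mathcal{P}=\{\mathcal{P}(v):v\in V_H\}$, where $\mathcal{P}(v)$ is a partition of $N_{S_2(H)}(v)$, such that for no loop $e$ at a vertex $v$ do $v_e^1$ and $v_e^2$ lie in the same class of $\mathcal{P}(v)$. If $H$ has a good subgraph, then for every function $\theta$ from the leaves of $S_2(H,\mathcal{P})$ to the positive integers, $S_2(H,\mathcal{P},\theta)$ is a DTDP-graph that is not a minimal DTDP-graph.
   Context: Graphs may have multiple edges and multiple loops. For a vertex $v$, $N_G(v)$ is the set of vertices adjacent to $v$ (a vertex with a loop is its own neighbour); degree $d_H(u)$ counts loops twice; a leaf is a vertex of degree 1. A set $D$ is dominating if every vertex not in $D$ has a neighbour in $D$; $T$ is total dominating if every vertex (including those in $T$) has a neighbour in $T$. A DT-pair is a pair of disjoint sets $(D,T)$ with $D$ dominating and $T$ total dominating; a graph is a DTDP-graph if it has a DT-pair. A connected graph is a minimal DTDP-graph if it is a DTDP-graph and no proper spanning subgraph (same vertex set, proper subset of edges and loops) is a DTDP-graph. 2-subdivision graphs: $S_2(H)$ is obtained from $H$ by inserting two new vertices into each edge and loop: for an edge $e$ with ends $u\ne v$ add $u_e,v_e$ and edges $uu_e,u_ev_e,v_ev$; for a loop $e$ at $v$ add $v_e^1,v_e^2$ and edges $vv_e^1,v_e^1v_e^2,v_e^2v$. $N_{S_2(H)}(v)$ is the set of new vertices adjacent to $v\in V_H$. $S_2(H,\mathcal{P})$ has vertex set $V_H\cup\{(v,A):A\in\mathcal{P}(v)\}$;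 each $v$ is joined by one edge to each $(v,A)$; each edge $e$ of $H$ with ends $u\ne v$ gives one edge joining $(u,B)$ and $(v,A)$ where $u_e\in B$, $v_e\in A$; each loop $e$ at $v$ gives one edge joining $(v,A)$, $(v,A')$ with $v_e^1\in A$, $v_e^2\in A'$. $S_2(H,\mathcal{P},\theta)$ replaces each leaf $x$ of $S_2(H,\mathcal{P})$ by $\theta(x)$ leaves adjacent to the neighbour of $x$. Good subgraph: let $Q$ be a subgraph of $H$ with no isolated vertex and $E_Q^-$ the set of edges/loops of $H$ not in $Q$ incident with a vertex of $Q$. Choose $E$ with $E_Q^-\subseteq E\subseteq E_H\setminus E_Q$ and orient each element of $E$; $d^\pm_H$ are out/in-degrees w.r.t. the arcs (an oriented loop contributes one to each). $Q$ is good if this can be done so that the arcs are partitioned into arc-disjoint digraphs $F_w$, $w\in V_Q$, with: (1) each $F_w$ is a union of arc-disjoint directed paths starting at $w$ (which may return to $w$ at their end, so directed cycles through $w$ are allowed); (2) every $x\notin V_Q$ has $d^+_H(x)\le 1$; (3) every vertex $x$ has $d^-_H(x)<d_H(x)$; (4) if $x$ lies in $F_w$ and $F_{w'}$, $w\ne w'$, then $x$ has out-degree $0$ in $F_w$ or in $F_{w'}$.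
   Formalization: In the definition of a good subgraph, each digraph F_w is required to contain at least one arc (and Q at least one vertex); if empty F_w were allowed, H = Q = K_2 would be a counterexample, since S_2(K_2) = P_4 is a minimal DTDP-graph. *)

theory Defs
  imports "Graph_Theory.Digraph_Component" "HOL-Library.Uprod" "HOL-Library.Disjoint_Sets"
begin

section \<open>Finite undirected graphs with multiple edges and loops\<close>

text \<open>
  Every edge carries an identity and has an unordered pair of ends; a loop at \<open>v\<close> is an edge
  with ends \<open>Upair v v\<close>, i.e. an edge whose ends do not satisfy \<^const>\<open>proper_uprod\<close>.
\<close>

record ('v, 'e) mgraph =
  vertices :: "'v set"
  edges :: "'e set"
  ends :: "'e \<Rightarrow> 'v uprod"

definition multigraph :: "('v, 'e) mgraph \<Rightarrow> bool" where
  "multigraph G \<longleftrightarrow> finite (vertices G) \<and> finite (edges G) \<and>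
     (\<forall>e \<in> edges G. set_uprod (ends G e) \<subseteq> vertices G)"

definition neighbours :: "('v, 'e) mgraph \<Rightarrow> 'v \<Rightarrow> 'v set" where
  "neighbours G v = {u. \<exists>e \<in> edges G. ends G e = Upair v u}"

definition degree :: "('v, 'e) mgraph \<Rightarrow> 'v \<Rightarrow> nat" where
  "degree G v = card {e \<in> edges G. v \<in> set_uprod (ends G e)}
              + card {e \<in> edges G. ends G e = Upair v v}"

definition is_leaf :: "('v, 'e) mgraph \<Rightarrow> 'v \<Rightarrow> bool" where
  "is_leaf G v \<longleftrightarrow> v \<in> vertices G \<and> degree G v = 1"

definition no_isolated_vertex :: "('v, 'e) mgraph \<Rightarrow> bool" where
  "no_isolated_vertex G \<longleftrightarrow> (\<forall>v \<in> vertices G. degree G v \<noteq> 0)"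

definition connected_graph :: "('v, 'e) mgraph \<Rightarrow> bool" where
  "connected_graph G \<longleftrightarrow> vertices G \<noteq> {} \<and>
     (\<forall>u \<in> vertices G. \<forall>v \<in> vertices G. (u, v) \<in> {(x, y). y \<in> neighbours G x}\<^sup>*)"

definition mg_subgraph :: "('v, 'e) mgraph \<Rightarrow> ('v, 'e) mgraph \<Rightarrow> bool" where
  "mg_subgraph Q G \<longleftrightarrow> multigraph Q \<and> vertices Q \<subseteq> vertices G \<and> edges Q \<subseteq> edges G \<and>
     (\<forall>e \<in> edges Q. ends Q e = ends G e)"

definition spanning_subgraph :: "('v, 'e) mgraph \<Rightarrow> ('v, 'e) mgraph \<Rightarrow> bool" where
  "spanning_subgraph Q G \<longleftrightarrow> mg_subgraph Q G \<and> vertices Q = vertices G"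


section \<open>Disjoint dominating and total dominating sets\<close>

definition dominating :: "('v, 'e) mgraph \<Rightarrow> 'v set \<Rightarrow> bool" where
  "dominating G D \<longleftrightarrow> D \<subseteq> vertices G \<and>
     (\<forall>v \<in> vertices G - D. neighbours G v \<inter> D \<noteq> {})"

definition total_dominating :: "('v, 'e) mgraph \<Rightarrow> 'v set \<Rightarrow> bool" where
  "total_dominating G T \<longleftrightarrow> T \<subseteq> vertices G \<and>
     (\<forall>v \<in> vertices G. neighbours G v \<inter> T \<noteq> {})"

definition DT_pair :: "('v, 'e) mgraph \<Rightarrow> 'v set \<Rightarrow> 'v set \<Rightarrow> bool" where
  "DT_pair G D T \<longleftrightarrow> D \<inter> T = {} \<and> dominating G D \<and> total_dominating G T"

definition DTDP_graph :: "('v, 'e) mgraph \<Rightarrow> bool" where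
  "DTDP_graph G \<longleftrightarrow> (\<exists>D T. DT_pair G D T)"

definition minimal_DTDP_graph :: "('v, 'e) mgraph \<Rightarrow> bool" where
  "minimal_DTDP_graph G \<longleftrightarrow> connected_graph G \<and> DTDP_graph G \<and>
     \<not> (\<exists>G'. spanning_subgraph G' G \<and> edges G' \<subset> edges G \<and> DTDP_graph G')"


section \<open>2-subdivision graphs\<close>

text \<open>
  \<open>New v e\<close> is the vertex $v_e$ for a non-loop \<open>e\<close> with end \<open>v\<close>; \<open>NewL1 v e\<close> and \<open>NewL2 v e\<close>
  are $v_e^1$ and $v_e^2$ for a loop \<open>e\<close> at \<open>v\<close>. The edges of $S_2(H)$ are, for each new
  vertex \<open>x\<close>, an edge \<open>Stem x\<close> joining \<open>x\<close> to the vertex \<open>base x\<close> of \<open>H\<close>, and, for each \<open>e\<close>, an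
  edge \<open>Mid e\<close> joining the two new vertices on \<open>e\<close>.
\<close>

datatype ('v, 'e) sub_vertex =
    Old (base: 'v)
  | New (base: 'v) 'e
  | NewL1 (base: 'v) 'e
  | NewL2 (base: 'v) 'e

datatype ('v, 'e) sub_edge = Stem "('v, 'e) sub_vertex" | Mid 'e

text \<open>The pair of new vertices on \<open>e\<close>; for a loop, the set of its ends is a singleton.\<close>

definition new_pair :: "('v, 'e) mgraph \<Rightarrow> 'e \<Rightarrow> ('v, 'e) sub_vertex uprod" where
  "new_pair H e =
     (if proper_uprod (ends H e) then map_uprod (\<lambda>v. New v e) (ends H e)
      else (let v = the_elem (set_uprod (ends H e)) in Upair (NewL1 v e) (NewL2 v e)))"

definition new_vertices :: "('v, 'e) mgraph \<Rightarrow> ('v, 'e) sub_vertex set" where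
  "new_vertices H = (\<Union>e \<in> edges H. set_uprod (new_pair H e))"

definition S2 :: "('v, 'e) mgraph \<Rightarrow> (('v, 'e) sub_vertex, ('v, 'e) sub_edge) mgraph" where
  "S2 H = \<lparr> vertices = Old ` vertices H \<union> new_vertices H,
            edges = Stem ` new_vertices H \<union> Mid ` edges H,
            ends = (\<lambda>f. case f of Stem x \<Rightarrow> Upair (Old (base x)) x | Mid e \<Rightarrow> new_pair H e) \<rparr>"


subsection \<open>The graphs $S_2(H, \mathcal{P})$\<close>

text \<open>\<open>PClass v A\<close> is the vertex $(v, A)$ with $A \in \mathcal{P}(v)$.\<close>

datatype ('v, 'e) part_vertex = POld 'v | PClass 'v "('v, 'e) sub_vertex set"

datatype ('v, 'e) part_edge = PStem 'v "('v, 'e) sub_vertex set" | PMid 'e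

definition class_vertex ::
    "('v \<Rightarrow> ('v, 'e) sub_vertex set set) \<Rightarrow> ('v, 'e) sub_vertex \<Rightarrow> ('v, 'e) part_vertex" where
  "class_vertex P x = PClass (base x) (THE A. A \<in> P (base x) \<and> x \<in> A)"

definition S2P :: "('v, 'e) mgraph \<Rightarrow> ('v \<Rightarrow> ('v, 'e) sub_vertex set set) \<Rightarrow>
    (('v, 'e) part_vertex, ('v, 'e) part_edge) mgraph" where
  "S2P H P =
     \<lparr> vertices = POld ` vertices H \<union> {PClass v A | v A. v \<in> vertices H \<and> A \<in> P v},
       edges = {PStem v A | v A. v \<in> vertices H \<and> A \<in> P v} \<union> PMid ` edges H,
       ends = (\<lambda>f. case f of PStem v A \<Rightarrow> Upair (POld v) (PClass v A)
                           | PMid e \<Rightarrow> map_uprod (class_vertex P) (new_pair H e)) \<rparr>"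


subsection \<open>Multiplying leaves\<close>

text \<open>
  Each leaf \<open>x\<close> is replaced by \<open>\<theta> x\<close> leaves \<open>Copy x i\<close>, \<open>i < \<theta> x\<close>, and the edge \<open>e\<close> at \<open>x\<close> by
  edges \<open>Copy e i\<close> joining \<open>Copy x i\<close> to the neighbour of \<open>x\<close>. The construction is meant for
  graphs in which no two leaves are adjacent, as is the case in $S_2(H, \mathcal{P})$, where
  every leaf is a vertex of \<open>H\<close> and these are pairwise non-adjacent.
\<close>

datatype 'a copied = Kept 'a | Copy 'a nat

definition multiply_leaves :: "('a, 'b) mgraph \<Rightarrow> ('a \<Rightarrow> nat) \<Rightarrow> ('a copied, 'b copied) mgraph" where
  "multiply_leaves G \<theta> =
     \<lparr> vertices = {Kept x | x. x \<in> vertices G \<and> \<not> is_leaf G x} \<union>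
                  {Copy x i | x i. is_leaf G x \<and> i < \<theta> x},
       edges = {Kept e | e. e \<in> edges G \<and> (\<forall>x \<in> set_uprod (ends G e). \<not> is_leaf G x)} \<union>
               {Copy e i | e i. e \<in> edges G \<and> (\<exists>x \<in> set_uprod (ends G e). is_leaf G x \<and> i < \<theta> x)},
       ends = (\<lambda>f. case f of
                 Kept e \<Rightarrow> map_uprod Kept (ends G e)
               | Copy e i \<Rightarrow> map_uprod (\<lambda>x. if is_leaf G x then Copy x i else Kept x) (ends G e)) \<rparr>"

definition S2P_theta :: "('v, 'e) mgraph \<Rightarrow> ('v \<Rightarrow> ('v, 'e) sub_vertex set set) \<Rightarrow>
    (('v, 'e) part_vertex \<Rightarrow> nat) \<Rightarrow>
    (('v, 'e) part_vertex copied, ('v, 'e) part_edge copied) mgraph" where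
  "S2P_theta H P \<theta> = multiply_leaves (S2P H P) \<theta>"


section \<open>Good subgraphs\<close>

definition boundary_edges :: "('v, 'e) mgraph \<Rightarrow> ('v, 'e) mgraph \<Rightarrow> 'e set" where
  "boundary_edges H Q = {e \<in> edges H - edges Q. set_uprod (ends H e) \<inter> vertices Q \<noteq> {}}"

text \<open>The digraph whose arcs are oriented versions of the edges of \<open>H\<close> in \<open>E\<close>.\<close>

definition orients :: "('v, 'e) mgraph \<Rightarrow> 'e set \<Rightarrow> ('v, 'e) pre_digraph \<Rightarrow> bool" where
  "orients H E A \<longleftrightarrow> verts A = vertices H \<and> arcs A = E \<and>
     (\<forall>e \<in> E. Upair (tail A e) (head A e) = ends H e)"

text \<open>
  Paths have at least one arc; besides ordinary paths, closed ones that return to the initial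
  vertex \<open>w\<close> at their end (in particular a loop at \<open>w\<close>) are allowed.
\<close>

definition dipath_from :: "('v, 'e) pre_digraph \<Rightarrow> 'v \<Rightarrow> 'e list \<Rightarrow> bool" where
  "dipath_from A w p \<longleftrightarrow> p \<noteq> [] \<and>
     ((\<exists>v. pre_digraph.apath A w p v) \<or>
      (pre_digraph.awalk A w p w \<and> distinct (tl (pre_digraph.awalk_verts A w p))))"

text \<open>
  The family of paths is required to be non-empty, so that each part of the partition of the arcs
  contains an arc. Dropping this would make $K_2$ a good subgraph of itself, although
  $S_2(K_2)$ is a path on four vertices, which is a minimal DTDP-graph.
\<close>

definition union_of_dipaths_from ::
    "('v, 'e) pre_digraph \<Rightarrow> 'v \<Rightarrow> ('v, 'e) pre_digraph \<Rightarrow> bool" where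
  "union_of_dipaths_from A w F \<longleftrightarrow> subgraph F A \<and>
     (\<exists>ps. ps \<noteq> {} \<and> (\<forall>p \<in> ps. dipath_from A w p) \<and>
        (\<forall>p \<in> ps. \<forall>q \<in> ps. p \<noteq> q \<longrightarrow> set p \<inter> set q = {}) \<and>
        arcs F = (\<Union>p \<in> ps. set p) \<and>
        verts F = (\<Union>p \<in> ps. set (pre_digraph.awalk_verts A w p)))"

definition good_subgraph :: "('v, 'e) mgraph \<Rightarrow> ('v, 'e) mgraph \<Rightarrow> bool" where
  "good_subgraph H Q \<longleftrightarrow>
     mg_subgraph Q H \<and> vertices Q \<noteq> {} \<and> no_isolated_vertex Q \<and>
     (\<exists>E A F.
        boundary_edges H Q \<subseteq> E \<and> E \<subseteq> edges H - edges Q \<and> orients H E A \<and>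
        (\<Union>w \<in> vertices Q. arcs (F w)) = arcs A \<and>
        disjoint_family_on (\<lambda>w. arcs (F w)) (vertices Q) \<and>
        (\<forall>w \<in> vertices Q. union_of_dipaths_from A w (F w)) \<and>
        (\<forall>x \<in> vertices H - vertices Q. out_degree A x \<le> 1) \<and>
        (\<forall>x \<in> vertices H. in_degree A x < degree H x) \<and>
        (\<forall>w \<in> vertices Q. \<forall>w' \<in> vertices Q. w \<noteq> w' \<longrightarrow>
           (\<forall>x \<in> verts (F w) \<inter> verts (F w'). out_degree (F w) x = 0 \<or> out_degree (F w') x = 0)))"

end

theory Submission
  imports Defs
begin

text \<open>
  It suffices to find an edge of $S_2(H, \mathcal{P})$ whose deletion leaves a DTDP-graph; the
  DT-pair is then copied to the multiplied leaves. If some class $A \in \mathcal{P}(u)$ has at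
  least two members, one of them on an edge \<open>uv\<close> of \<open>H\<close> with \<open>v\<close> of degree at least 2, a small
  change of the pair formed by the old vertices and the classes does it. Otherwise every class with
  at least two members consists of new vertices on edges to leaves of \<open>H\<close>. A good subgraph \<open>Q\<close> and
  its arcs avoid such edges, so all classes that matter are singletons, as in $S_2(H)$. Let \<open>W\<close> be
  the least set of vertices that contains the vertices of \<open>Q\<close> and every vertex whose edges are all
  arcs, exactly one of them outgoing and at least one of them coming from \<open>W\<close>. Now move \<open>W\<close> into
  the total dominating set, and move into the dominating set both new vertices on each edge of \<open>Q\<close>,
  the new vertex at the head of each arc that starts in \<open>W\<close>, and the one at the tail of each arc
  that only ends in \<open>W\<close>. The edge joining the two new vertices on an edge of \<open>Q\<close> is then not used
  and can be deleted.
\<close>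

section \<open>Spanning subgraphs and multiplied leaves\<close>

abbreviation restrict_edges :: "('v, 'e) mgraph \<Rightarrow> 'e set \<Rightarrow> ('v, 'e) mgraph" where
  "restrict_edges G R \<equiv> G\<lparr>edges := R\<rparr>"

lemma spanning_subgraph_restrict_edges:
  assumes "multigraph G" "R \<subseteq> edges G"
  shows "spanning_subgraph (restrict_edges G R) G"
  using assms by (auto simp: spanning_subgraph_def mg_subgraph_def multigraph_def finite_subset subset_eq)

lemma DTDP_graph_spanning_mono:
  assumes "spanning_subgraph G' G" "DTDP_graph G'"
  shows "DTDP_graph G"
proof -
  have nb: "neighbours G' v \<subseteq> neighbours G v" for v
    using assms(1) by (force simp: spanning_subgraph_def mg_subgraph_def neighbours_def)
  have V: "vertices G' = vertices G" using assms(1) by (simp add: spanning_subgraph_def)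
  obtain D T where "DT_pair G' D T" using assms(2) by (auto simp: DTDP_graph_def)
  then have "DT_pair G D T"
    using nb unfolding DT_pair_def dominating_def total_dominating_def V by blast
  then show ?thesis by (auto simp: DTDP_graph_def)
qed

section \<open>Lifting DT-pairs to multiplied leaves\<close>

fun original :: "'a copied \<Rightarrow> 'a" where
  "original (Kept x) = x"
| "original (Copy x i) = x"

text \<open>The second assumption excludes an edge between two leaves \<open>x\<close> and
  \<open>y\<close>: there \<open>Copy e i\<close> could have \<open>i < \<theta> x\<close> but
  \<open>\<theta> y \<le> i\<close>, and then its end \<open>Copy y i\<close> is no vertex.\<close>

lemma multigraph_multiply_leaves:
  assumes "multigraph G"
    and leaves: "\<And>e x y. e \<in> edges G \<Longrightarrow> ends G e = Upair x y \<Longrightarrow> \<not> (is_leaf G x \<and> is_leaf G y)"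
  shows "multigraph (multiply_leaves G \<theta>)"
proof -
  let ?M = "multiply_leaves G \<theta>"
  let ?V = "Kept ` vertices G \<union> (\<Union>x \<in> vertices G. Copy x ` {..<\<theta> x})"
  let ?E = "Kept ` edges G \<union> (\<Union>e \<in> edges G. \<Union>x \<in> vertices G. Copy e ` {..<\<theta> x})"
  have fin: "finite (vertices G)" "finite (edges G)"
    and ends: "\<And>e. e \<in> edges G \<Longrightarrow> set_uprod (ends G e) \<subseteq> vertices G"
    using assms by (auto simp: multigraph_def)
  have "vertices ?M \<subseteq> ?V" by (auto simp: multiply_leaves_def is_leaf_def)
  moreover have "edges ?M \<subseteq> ?E"
  proof
    fix f assume f: "f \<in> edges ?M"
    show "f \<in> ?E"
    proof (cases f)
      case (Kept e)
      then show ?thesis using f by (auto simp: multiply_leaves_def)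
    next
      case (Copy e i)
      then obtain x where "e \<in> edges G" "x \<in> set_uprod (ends G e)" "i < \<theta> x"
        using f by (auto simp: multiply_leaves_def)
      moreover from this have "x \<in> vertices G" using ends by blast
      ultimately show ?thesis using Copy by blast
    qed
  qed
  moreover have "finite ?V" "finite ?E" using fin by auto
  moreover have "set_uprod (ends ?M f) \<subseteq> vertices ?M" if f: "f \<in> edges ?M" for f
  proof -
    have e: "original f \<in> edges G" using f by (auto simp: multiply_leaves_def)
    obtain x y where xy: "ends G (original f) = Upair x y" by (cases "ends G (original f)")
    show ?thesis
      using f e xy ends[OF e] leaves[OF e xy] by (cases f) (auto simp: multiply_leaves_def)
  qed
  ultimately show ?thesis unfolding multigraph_def by (meson finite_subset)
qed

text \<open>The preimages of \<open>D\<close> and \<open>T\<close> under \<open>original\<close>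
  form a DT-pair in the preimage of the smaller graph, because neighbours lift along
  \<open>original\<close>. Leaves are always those of \<open>G\<close>, also after the
  deletion.\<close>

lemma multiply_leaves_not_minimal:
  fixes \<theta> :: "'a \<Rightarrow> nat"
  assumes G: "multigraph G"
    and R: "R \<subset> edges G" "DTDP_graph (restrict_edges G R)"
    and leaves: "\<And>e x y. e \<in> edges G \<Longrightarrow> ends G e = Upair x y \<Longrightarrow> \<not> (is_leaf G x \<and> is_leaf G y)"
    and pos: "\<And>x. is_leaf G x \<Longrightarrow> 0 < \<theta> x"
  shows "DTDP_graph (multiply_leaves G \<theta>) \<and> \<not> minimal_DTDP_graph (multiply_leaves G \<theta>)"
proof -
  let ?M = "multiply_leaves G \<theta>"
  let ?G = "restrict_edges G R"
  let ?S = "{f \<in> edges ?M. original f \<in> R}"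
  let ?L = "restrict_edges ?M ?S"
  have span: "spanning_subgraph ?L ?M"
    by (rule spanning_subgraph_restrict_edges[OF multigraph_multiply_leaves[OF G leaves]]) auto
  \<comment> \<open>A kept vertex is joined to copy 0 of an adjacent leaf, which exists since
    \<open>\<theta>\<close> is positive; copy \<open>i\<close> of a leaf is joined through
    \<open>Copy e i\<close> to a kept vertex.\<close>
  have lift: "\<exists>z' \<in> vertices ?M. original z' = y \<and> z' \<in> neighbours ?L z"
    if z: "z \<in> vertices ?M" and y: "y \<in> neighbours ?G (original z)" for z y
  proof -
    obtain e where e: "e \<in> R" "ends G e = Upair (original z) y"
      using y by (auto simp: neighbours_def)
    have eG: "e \<in> edges G" using e R by auto
    have yV: "y \<in> vertices G" using G eG e by (auto simp: multigraph_def)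
    show ?thesis
    proof (cases z)
      case (Kept x)
      have x: "\<not> is_leaf G x" using z Kept by (auto simp: multiply_leaves_def)
      show ?thesis
      proof (cases "is_leaf G y")
        case True
        have "Copy y 0 \<in> vertices ?M" "Copy e 0 \<in> ?S" "ends ?M (Copy e 0) = Upair z (Copy y 0)"
          using True pos[OF True] e eG x Kept by (auto simp: multiply_leaves_def)
        then show ?thesis by (intro bexI[of _ "Copy y 0"]) (auto simp: neighbours_def)
      next
        case False
        have "Kept y \<in> vertices ?M" "Kept e \<in> ?S" "ends ?M (Kept e) = Upair z (Kept y)"
          using False e eG x yV Kept by (auto simp: multiply_leaves_def)
        then show ?thesis by (intro bexI[of _ "Kept y"]) (auto simp: neighbours_def)
      qed
    next
      case (Copy x i)
      have x: "is_leaf G x" "i < \<theta> x" using z Copy by (auto simp: multiply_leaves_def)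
      have y: "\<not> is_leaf G y" using leaves[OF eG e(2)] x Copy by auto
      have "Kept y \<in> vertices ?M" "Copy e i \<in> ?S" "ends ?M (Copy e i) = Upair z (Kept y)"
        using y x e eG yV Copy by (auto simp: multiply_leaves_def)
      then show ?thesis by (intro bexI[of _ "Kept y"]) (auto simp: neighbours_def)
    qed
  qed
  have orig: "original z \<in> vertices G" if "z \<in> vertices ?M" for z
    using that by (auto simp: multiply_leaves_def is_leaf_def)
  obtain D T where DT: "DT_pair ?G D T" using R by (auto simp: DTDP_graph_def)
  let ?lift = "\<lambda>X. {z \<in> vertices ?M. original z \<in> X}"
  have "dominating ?L (?lift D)"
    unfolding dominating_def
  proof (intro conjI ballI)
    fix z assume "z \<in> vertices ?L - ?lift D"
    then have z: "z \<in> vertices ?M" "original z \<in> vertices G - D" using orig by auto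
    then obtain y where "y \<in> neighbours ?G (original z)" "y \<in> D"
      using DT unfolding DT_pair_def dominating_def by fastforce
    with lift[OF z(1)] show "neighbours ?L z \<inter> ?lift D \<noteq> {}" by fastforce
  qed auto
  moreover have "total_dominating ?L (?lift T)"
    unfolding total_dominating_def
  proof (intro conjI ballI)
    fix z assume "z \<in> vertices ?L"
    then have z: "z \<in> vertices ?M" "original z \<in> vertices G" using orig by auto
    then obtain y where "y \<in> neighbours ?G (original z)" "y \<in> T"
      using DT unfolding DT_pair_def total_dominating_def by fastforce
    with lift[OF z(1)] show "neighbours ?L z \<inter> ?lift T \<noteq> {}" by fastforce
  qed auto
  moreover have "?lift D \<inter> ?lift T = {}" using DT by (auto simp: DT_pair_def)
  ultimately have L: "DTDP_graph ?L" by (auto simp: DTDP_graph_def DT_pair_def)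
  obtain e where e: "e \<in> edges G" "e \<notin> R" using R by auto
  \<comment> \<open>The edge missing from \<open>R\<close> has at least one copy, so the spanning
    subgraph is proper.\<close>
  have "\<exists>f \<in> edges ?M. original f = e"
  proof (cases "\<exists>x \<in> set_uprod (ends G e). is_leaf G x")
    case True
    then have "Copy e 0 \<in> edges ?M" using e pos by (auto simp: multiply_leaves_def)
    then show ?thesis by (rule bexI[rotated]) simp
  next
    case False
    then have "Kept e \<in> edges ?M" using e by (auto simp: multiply_leaves_def)
    then show ?thesis by (rule bexI[rotated]) simp
  qed
  then have "edges ?L \<subset> edges ?M" using e by auto
  with span L DTDP_graph_spanning_mono[OF span L] show ?thesis
    unfolding minimal_DTDP_graph_def by blast
qed

section \<open>Half-edges\<close>

fun parent_edge :: "('v, 'e) sub_vertex \<Rightarrow> 'e" where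
  "parent_edge (Old v) = undefined"
| "parent_edge (New v e) = e"
| "parent_edge (NewL1 v e) = e"
| "parent_edge (NewL2 v e) = e"

text \<open>The new vertices are treated as the half-edges of \<open>H\<close>; \<open>mate H x\<close> is the other half of
  the same edge.\<close>

definition mate :: "('v, 'e) mgraph \<Rightarrow> ('v, 'e) sub_vertex \<Rightarrow> ('v, 'e) sub_vertex" where
  "mate H x = (THE y. new_pair H (parent_edge x) = Upair x y)"

definition half_edges_at :: "('v, 'e) mgraph \<Rightarrow> 'v \<Rightarrow> ('v, 'e) sub_vertex set" where
  "half_edges_at H v = {x \<in> new_vertices H. base x = v}"

lemma new_pair_simps:
  "ends H e = Upair u v \<Longrightarrow> u \<noteq> v \<Longrightarrow> new_pair H e = Upair (New u e) (New v e)"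
  "ends H e = Upair v v \<Longrightarrow> new_pair H e = Upair (NewL1 v e) (NewL2 v e)"
  by (auto simp: new_pair_def)

lemma new_pair_cases:
  obtains u v where "ends H e = Upair u v" "u \<noteq> v" "new_pair H e = Upair (New u e) (New v e)"
  | v where "ends H e = Upair v v" "new_pair H e = Upair (NewL1 v e) (NewL2 v e)"
  using new_pair_simps by (metis uprod_exhaust)

lemma parent_edge_new_pair: "x \<in> set_uprod (new_pair H e) \<Longrightarrow> parent_edge x = e"
  by (cases H e rule: new_pair_cases) auto

text \<open>One entry of an unordered pair determines the other, so the description in
  \<open>mate\<close> is unique. Mates differ even on a loop, where they are built by
  \<open>NewL1\<close> and \<open>NewL2\<close>.\<close>

lemma new_vertices_mate:
  assumes "x \<in> new_vertices H"
  shows parent_edge_in: "parent_edge x \<in> edges H"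
    and new_pair_mate: "new_pair H (parent_edge x) = Upair x (mate H x)"
    and mate_in: "mate H x \<in> new_vertices H"
    and mate_neq: "mate H x \<noteq> x"
    and parent_edge_mate: "parent_edge (mate H x) = parent_edge x"
    and ends_mate: "ends H (parent_edge x) = Upair (base x) (base (mate H x))"
proof -
  obtain e where e: "e \<in> edges H" "x \<in> set_uprod (new_pair H e)"
    using assms by (auto simp: new_vertices_def)
  have pe: "parent_edge x = e" using e parent_edge_new_pair by fast
  then show in_edges: "parent_edge x \<in> edges H" using e by simp
  obtain y where y: "new_pair H e = Upair x y"
    using e(2) by (cases "new_pair H e") auto
  then have mate: "mate H x = y" unfolding mate_def pe by auto
  show new_pair: "new_pair H (parent_edge x) = Upair x (mate H x)" using y pe mate by simp
  show "mate H x \<in> new_vertices H"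
    using in_edges new_pair by (force simp: new_vertices_def)
  show "mate H x \<noteq> x" 
    using new_pair by (cases x; cases H "parent_edge x" rule: new_pair_cases) auto
  show "parent_edge (mate H x) = parent_edge x"
    using new_pair parent_edge_new_pair[of "mate H x" H "parent_edge x"] by simp
  show "ends H (parent_edge x) = Upair (base x) (base (mate H x))"
    using new_pair
    by (cases x; cases "mate H x"; cases H "parent_edge x" rule: new_pair_cases) auto
qed

lemma mate_mate:
  assumes "x \<in> new_vertices H"
  shows "mate H (mate H x) = x"
proof -
  have "Upair x (mate H x) = Upair (mate H x) (mate H (mate H x))"
    using new_pair_mate[OF assms] new_pair_mate[OF mate_in[OF assms]] parent_edge_mate[OF assms]
    by simp
  then show ?thesis by auto
qed

lemma new_vertices_same_parent:
  assumes "x \<in> new_vertices H" "y \<in> new_vertices H" "parent_edge x = parent_edge y"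
  shows "y = x \<or> y = mate H x"
proof -
  have "Upair x (mate H x) = Upair y (mate H y)"
    using new_pair_mate[OF assms(1)] new_pair_mate[OF assms(2)] assms(3) by metis
  then show ?thesis by auto
qed

text \<open>Selects the half of \<open>e\<close> at a prescribed end; this later represents an arc
  by the half at its head.\<close>

lemma ex_new_vertex:
  assumes "e \<in> edges H" "ends H e = Upair u v"
  obtains x where "x \<in> new_vertices H" "parent_edge x = e" "base x = u" "base (mate H x) = v"
proof -
  have "\<exists>x \<in> set_uprod (new_pair H e). base x = u"
    using assms(2) by (cases H e rule: new_pair_cases) auto
  then obtain x where x: "x \<in> set_uprod (new_pair H e)" "base x = u" by auto
  then have xN: "x \<in> new_vertices H" using assms by (auto simp: new_vertices_def)
  have pe: "parent_edge x = e" using x parent_edge_new_pair by fast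
  have "base (mate H x) = v" using ends_mate[OF xN] pe assms(2) x(2) by auto
  with xN pe x(2) that show ?thesis by blast
qed

lemma base_in_vertices:
  assumes "multigraph H" "x \<in> new_vertices H"
  shows "base x \<in> vertices H"
proof -
  have "set_uprod (ends H (parent_edge x)) \<subseteq> vertices H"
    using assms(1) parent_edge_in[OF assms(2)] by (simp add: multigraph_def)
  then show ?thesis using ends_mate[OF assms(2)] by simp
qed

lemma finite_new_vertices: "multigraph H \<Longrightarrow> finite (new_vertices H)"
  by (auto simp: new_vertices_def multigraph_def)

lemma finite_half_edges_at: "multigraph H \<Longrightarrow> finite (half_edges_at H v)"
  by (simp add: half_edges_at_def finite_new_vertices)

text \<open>A loop has two halves at its vertex, matching the second summand of
  \<open>degree\<close>.\<close>

lemma degree_eq_card_half_edges_at: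
  assumes "multigraph H"
  shows "degree H v = card (half_edges_at H v)"
proof -
  have fin: "finite (edges H)" using assms by (simp add: multigraph_def)
  let ?N = "{e \<in> edges H. v \<in> set_uprod (ends H e) \<and> ends H e \<noteq> Upair v v}"
  let ?L = "{e \<in> edges H. ends H e = Upair v v}"
  have half_edges: "half_edges_at H v = New v ` ?N \<union> (NewL1 v ` ?L \<union> NewL2 v ` ?L)"
  proof (intro set_eqI iffI)
    fix x assume "x \<in> half_edges_at H v"
    then obtain e where "e \<in> edges H" "x \<in> set_uprod (new_pair H e)" "base x = v"
      by (auto simp: half_edges_at_def new_vertices_def)
    then show "x \<in> New v ` ?N \<union> (NewL1 v ` ?L \<union> NewL2 v ` ?L)"
      by (cases H e rule: new_pair_cases) auto
  next
    fix x assume x: "x \<in> New v ` ?N \<union> (NewL1 v ` ?L \<union> NewL2 v ` ?L)"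
    then obtain e where e: "e \<in> edges H" "x = New v e \<and> e \<in> ?N \<or> x \<in> {NewL1 v e, NewL2 v e} \<and> e \<in> ?L"
      by auto
    then have "x \<in> set_uprod (new_pair H e) \<and> base x = v"
      by (cases H e rule: new_pair_cases) auto
    with e show "x \<in> half_edges_at H v" by (auto simp: half_edges_at_def new_vertices_def)
  qed
  have "card (New v ` ?N \<union> (NewL1 v ` ?L \<union> NewL2 v ` ?L)) = card ?N + (card ?L + card ?L)"
  proof -
    have "card (New v ` ?N) = card ?N" "card (NewL1 v ` ?L) = card ?L" "card (NewL2 v ` ?L) = card ?L"
      by (intro card_image inj_onI; simp)+
    moreover have "finite (New v ` ?N)" "finite (NewL1 v ` ?L)" "finite (NewL2 v ` ?L)"
      using fin by simp_all
    moreover have "NewL1 v ` ?L \<inter> NewL2 v ` ?L = {}" "New v ` ?N \<inter> (NewL1 v ` ?L \<union> NewL2 v ` ?L) = {}"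
      by blast+
    ultimately show ?thesis by (simp add: card_Un_disjoint)
  qed
  then have "card (half_edges_at H v) = card ?N + card ?L + card ?L"
    unfolding half_edges by simp
  moreover have "{e \<in> edges H. v \<in> set_uprod (ends H e)} = ?N \<union> ?L" by auto
  moreover have "card (?N \<union> ?L) = card ?N + card ?L"
    by (rule card_Un_disjoint) (use fin in auto)
  ultimately show ?thesis by (simp add: degree_def)
qed

lemma neighbours_S2_Old: "neighbours (S2 H) (Old v) = half_edges_at H v"
proof (intro set_eqI iffI)
  fix x assume "x \<in> neighbours (S2 H) (Old v)"
  then obtain f where f: "f \<in> edges (S2 H)" "ends (S2 H) f = Upair (Old v) x"
    by (auto simp: neighbours_def)
  have no_Old: "new_pair H e \<noteq> Upair (Old v) x" for e
    by (cases H e rule: new_pair_cases) auto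
  \<comment> \<open>Pairs are unordered, so \<open>Old v\<close> might also match the new end of a
    stem; this rules that out.\<close>
  have "y \<noteq> Old w" if "y \<in> new_vertices H" for y w
    using ends_mate[OF that] new_pair_mate[OF that]
    by (cases H "parent_edge y" rule: new_pair_cases) auto
  with f no_Old show "x \<in> half_edges_at H v"
    by (auto simp: S2_def half_edges_at_def)
next
  fix x assume "x \<in> half_edges_at H v"
  then show "x \<in> neighbours (S2 H) (Old v)"
    unfolding neighbours_def by (intro CollectI bexI[of _ "Stem x"])
      (auto simp: S2_def half_edges_at_def)
qed

section \<open>The graphs \<open>S2P\<close>\<close>

locale partitioned_graph =
  fixes H :: "('v, 'e) mgraph" and P :: "'v \<Rightarrow> ('v, 'e) sub_vertex set set"
  assumes multigraph: "multigraph H"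
    and no_isolated: "no_isolated_vertex H"
    and partition: "v \<in> vertices H \<Longrightarrow> partition_on (neighbours (S2 H) (Old v)) (P v)"
    and loops_split: "e \<in> edges H \<Longrightarrow> ends H e = Upair v v \<Longrightarrow>
      \<not> (\<exists>A \<in> P v. NewL1 v e \<in> A \<and> NewL2 v e \<in> A)"
begin

section \<open>Classes of half-edges\<close>

definition class_of :: "('v, 'e) sub_vertex \<Rightarrow> ('v, 'e) sub_vertex set" where
  "class_of x = (THE A. A \<in> P (base x) \<and> x \<in> A)"

lemma class_vertex_eq: "class_vertex P x = PClass (base x) (class_of x)"
  by (simp add: class_vertex_def class_of_def)

lemma half_edges_at_nonempty: "v \<in> vertices H \<Longrightarrow> half_edges_at H v \<noteq> {}"
  using no_isolated degree_eq_card_half_edges_at[OF multigraph, of v]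
  by (auto simp: no_isolated_vertex_def)

lemma Union_classes: "v \<in> vertices H \<Longrightarrow> \<Union> (P v) = half_edges_at H v"
  using partition_onD1[OF partition] by (simp add: neighbours_S2_Old)

lemma class_of_eq:
  assumes "v \<in> vertices H" "A \<in> P v" "x \<in> A"
  shows "x \<in> new_vertices H" "base x = v" "class_of x = A"
proof -
  show x: "x \<in> new_vertices H" "base x = v"
    using Union_classes[OF assms(1)] assms(2,3) by (auto simp: half_edges_at_def)
  show "class_of x = A" unfolding class_of_def
  proof (rule the_equality)
    fix B assume "B \<in> P (base x) \<and> x \<in> B"
    then show "B = A"
      using partition_onD2[OF partition[OF assms(1)]] assms(2,3) x(2)
      by (auto simp: disjoint_def)
  qed (use assms x in auto)
qed

lemma class_of_in:
  assumes "x \<in> new_vertices H"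
  shows "class_of x \<in> P (base x)" "x \<in> class_of x"
proof -
  have v: "base x \<in> vertices H" using base_in_vertices[OF multigraph assms] .
  have "x \<in> \<Union> (P (base x))" using assms Union_classes[OF v] by (auto simp: half_edges_at_def)
  then obtain A where A: "A \<in> P (base x)" "x \<in> A" by auto
  then have "class_of x = A" by (rule class_of_eq(3)[OF v])
  with A show "class_of x \<in> P (base x)" "x \<in> class_of x" by auto
qed

lemma class_of_member:
  assumes "x \<in> new_vertices H" "y \<in> class_of x"
  shows "y \<in> new_vertices H" "base y = base x" "class_of y = class_of x"
  using class_of_eq[OF base_in_vertices[OF multigraph assms(1)] class_of_in(1)[OF assms(1)] assms(2)]
  by auto

lemma class_obtain:
  assumes "v \<in> vertices H" "A \<in> P v"
  obtains x where "x \<in> half_edges_at H v" "A = class_of x"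
proof -
  have "A \<noteq> {}" using partition_onD3[OF partition[OF assms(1)]] assms(2) by auto
  then obtain x where "x \<in> A" by auto
  with class_of_eq[OF assms this] that show ?thesis by (auto simp: half_edges_at_def)
qed

text \<open>Members of a class have the same base, so an edge with both halves in one class would be
  a loop, contrary to \<open>loops_split\<close>.\<close>

lemma mate_notin_class:
  assumes "x \<in> new_vertices H"
  shows "mate H x \<notin> class_of x"
proof
  assume m: "mate H x \<in> class_of x"
  let ?e = "parent_edge x" and ?v = "base x"
  have loop: "ends H ?e = Upair ?v ?v" using ends_mate[OF assms] class_of_member(2)[OF assms m] by simp
  have "{x, mate H x} = {NewL1 ?v ?e, NewL2 ?v ?e}"
  proof -
    have "Upair x (mate H x) = Upair (NewL1 ?v ?e) (NewL2 ?v ?e)"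
      using new_pair_mate[OF assms] new_pair_simps(2)[OF loop] by metis
    then show ?thesis by auto
  qed
  then have "{NewL1 ?v ?e, NewL2 ?v ?e} \<subseteq> class_of x"
    using class_of_in(2)[OF assms] m by (metis empty_subsetI insert_subset)
  then show False
    using loops_split[OF parent_edge_in[OF assms] loop] class_of_in(1)[OF assms] by blast
qed

text \<open>Classes are non-empty, so the pairs (v, A) can be indexed by half-edges; from here on a
  class vertex has the form \<open>PClass (base x) (class_of x)\<close>.\<close>

lemma class_iff:
  "v \<in> vertices H \<and> A \<in> P v \<longleftrightarrow> (\<exists>x \<in> new_vertices H. v = base x \<and> A = class_of x)"
proof
  assume "v \<in> vertices H \<and> A \<in> P v"
  then obtain x where "x \<in> half_edges_at H v" "A = class_of x" using class_obtain by blast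
  then show "\<exists>x \<in> new_vertices H. v = base x \<and> A = class_of x" by (auto simp: half_edges_at_def)
next
  assume "\<exists>x \<in> new_vertices H. v = base x \<and> A = class_of x"
  then show "v \<in> vertices H \<and> A \<in> P v"
    using class_of_in(1) base_in_vertices[OF multigraph] by blast
qed

section \<open>Vertices, edges and leaves of \<open>S2P H P\<close>\<close>

lemma vertices_S2P:
  "vertices (S2P H P) = POld ` vertices H \<union> {PClass (base x) (class_of x) | x. x \<in> new_vertices H}"
  by (auto simp: S2P_def class_iff)

lemma edges_S2P:
  "edges (S2P H P) = {PStem (base x) (class_of x) | x. x \<in> new_vertices H} \<union> PMid ` edges H"
  by (auto simp: S2P_def class_iff)

lemma ends_PStem: "ends (S2P H P) (PStem v A) = Upair (POld v) (PClass v A)"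
  by (simp add: S2P_def)

lemma ends_PMid:
  "x \<in> new_vertices H \<Longrightarrow> ends (S2P H P) (PMid (parent_edge x)) =
    Upair (PClass (base x) (class_of x)) (PClass (base (mate H x)) (class_of (mate H x)))"
  by (simp add: S2P_def new_pair_mate class_vertex_eq)

lemma ex_half_edge: "e \<in> edges H \<Longrightarrow> \<exists>x \<in> new_vertices H. parent_edge x = e"
  by (metis ex_new_vertex uprod_exhaust)

lemma multigraph_S2P: "multigraph (S2P H P)"
  unfolding multigraph_def
proof (intro conjI ballI)
  have fin: "finite (new_vertices H)" using finite_new_vertices[OF multigraph] .
  show "finite (vertices (S2P H P))" "finite (edges (S2P H P))"
    unfolding vertices_S2P edges_S2P using multigraph fin by (auto simp: multigraph_def)
  fix f assume "f \<in> edges (S2P H P)"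
  then consider x where "x \<in> new_vertices H" "f = PStem (base x) (class_of x)"
    | x where "x \<in> new_vertices H" "f = PMid (parent_edge x)"
    unfolding edges_S2P using ex_half_edge by blast
  then show "set_uprod (ends (S2P H P) f) \<subseteq> vertices (S2P H P)"
  proof cases
    case 1
    then show ?thesis
      using base_in_vertices[OF multigraph 1(1)] by (auto simp: ends_PStem vertices_S2P)
  next
    case 2
    then show ?thesis using mate_in[OF 2(1)] by (auto simp: ends_PMid vertices_S2P)
  qed
qed

text \<open>Its stem and the middle edge of any member are two distinct incident edges.\<close>

lemma class_vertex_not_leaf:
  assumes "x \<in> new_vertices H"
  shows "\<not> is_leaf (S2P H P) (PClass (base x) (class_of x))" (is "\<not> is_leaf ?G ?c")
proof -
  let ?I = "{e \<in> edges ?G. ?c \<in> set_uprod (ends ?G e)}"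
  have "{PStem (base x) (class_of x), PMid (parent_edge x)} \<subseteq> ?I"
    using assms parent_edge_in[OF assms] by (auto simp: edges_S2P ends_PStem ends_PMid)
  moreover have "finite ?I" using multigraph_S2P by (simp add: multigraph_def)
  ultimately have "card {PStem (base x) (class_of x), PMid (parent_edge x)} \<le> card ?I"
    by (intro card_mono)
  then show ?thesis by (simp add: is_leaf_def degree_def)
qed

text \<open>Every edge has a class vertex as an end, and class vertices are not leaves.\<close>

lemma leaves_not_adjacent:
  assumes "f \<in> edges (S2P H P)" "ends (S2P H P) f = Upair a b"
  shows "\<not> (is_leaf (S2P H P) a \<and> is_leaf (S2P H P) b)"
proof -
  have "\<exists>x \<in> new_vertices H. PClass (base x) (class_of x) \<in> set_uprod (ends (S2P H P) f)"
  proof (cases "\<exists>e. f = PMid e")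
    case True
    then obtain x where "x \<in> new_vertices H" "f = PMid (parent_edge x)"
      using assms(1) ex_half_edge unfolding edges_S2P by blast
    then show ?thesis by (auto simp: ends_PMid)
  next
    case False
    then show ?thesis using assms(1) by (auto simp: edges_S2P ends_PStem)
  qed
  then show ?thesis using class_vertex_not_leaf assms(2) by auto
qed

section \<open>Deleting one edge of \<open>S2P H P\<close>\<close>

text \<open>The old vertices in \<open>W\<close> and the classes contained in \<open>X\<close> form the total dominating set,
  all other vertices the dominating set.\<close>

lemma DTDP_delete_edge:
  assumes X: "\<And>x y. x \<in> new_vertices H \<Longrightarrow> y \<in> class_of x \<Longrightarrow> y \<in> X \<longleftrightarrow> x \<in> X"
    and old_T: "\<And>v. v \<in> vertices H \<Longrightarrow> \<exists>x \<in> half_edges_at H v. x \<in> X \<and> PStem v (class_of x) \<noteq> f"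
    and old_D: "\<And>v. v \<in> W \<Longrightarrow> \<exists>x \<in> half_edges_at H v. x \<notin> X \<and> PStem v (class_of x) \<noteq> f"
    and class_stem: "\<And>x. x \<in> new_vertices H \<Longrightarrow> x \<in> X \<or> base x \<in> W \<Longrightarrow>
      PStem (base x) (class_of x) \<noteq> f"
    and class_D: "\<And>x. x \<in> X \<Longrightarrow> x \<in> new_vertices H \<Longrightarrow> base x \<in> W \<Longrightarrow>
      \<exists>y \<in> class_of x. mate H y \<notin> X \<and> PMid (parent_edge y) \<noteq> f"
    and class_T: "\<And>x. x \<in> new_vertices H \<Longrightarrow> base x \<notin> W \<Longrightarrow>
      \<exists>y \<in> class_of x. mate H y \<in> X \<and> PMid (parent_edge y) \<noteq> f"
  shows "DTDP_graph (restrict_edges (S2P H P) (edges (S2P H P) - {f}))" (is "DTDP_graph ?G")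
proof -
  define inT where "inT z \<longleftrightarrow> (case z of POld v \<Rightarrow> v \<in> W | PClass v A \<Rightarrow> A \<subseteq> X)"
    for z :: "('v, 'e) part_vertex"
  let ?C = "\<lambda>x. PClass (base x) (class_of x)"
  \<comment> \<open>By the assumption \<open>X\<close> a class lies inside \<open>X\<close> or
    misses it, so any one member decides.\<close>
  have inT_class: "inT (?C x) \<longleftrightarrow> x \<in> X" if "x \<in> new_vertices H" for x
  proof -
    have "inT (?C x) \<longleftrightarrow> class_of x \<subseteq> X" by (simp add: inT_def)
    then show ?thesis using X[OF that] class_of_in(2)[OF that] by blast
  qed
  have stem: "?C x \<in> neighbours ?G (POld v)" "POld v \<in> neighbours ?G (?C x)"
    if "x \<in> new_vertices H" "base x = v" "PStem v (class_of x) \<noteq> f" for x v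
  proof -
    have "PStem v (class_of x) \<in> edges ?G" using that by (auto simp: edges_S2P)
    then show "?C x \<in> neighbours ?G (POld v)" "POld v \<in> neighbours ?G (?C x)"
      unfolding neighbours_def using that(2) ends_PStem
      by (auto intro!: bexI[of _ "PStem v (class_of x)"])
  qed
  have mid: "?C (mate H y) \<in> neighbours ?G (?C x)"
    if "x \<in> new_vertices H" "y \<in> class_of x" "PMid (parent_edge y) \<noteq> f" for x y
  proof -
    note y = class_of_member[OF that(1,2)]
    have "PMid (parent_edge y) \<in> edges ?G"
      using that(3) parent_edge_in[OF y(1)] by (auto simp: edges_S2P)
    then show ?thesis
      unfolding neighbours_def using ends_PMid[OF y(1)] y
      by (auto intro!: bexI[of _ "PMid (parent_edge y)"])
  qed
  have V: "vertices ?G = vertices (S2P H P)" by simp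
  let ?T = "{z \<in> vertices ?G. inT z}" and ?D = "{z \<in> vertices ?G. \<not> inT z}"
  have CV: "?C x \<in> vertices ?G" if "x \<in> new_vertices H" for x
    using that by (auto simp: vertices_S2P)
  have OV: "POld (base x) \<in> vertices ?G" if "x \<in> new_vertices H" for x
    using base_in_vertices[OF multigraph that] by (auto simp: vertices_S2P)
  \<comment> \<open>A class uses its old vertex if that lies in \<open>W\<close>, and a middle edge
    otherwise. For domination below the two cases are exchanged, and only vertices in
    \<open>?T\<close> need attention.\<close>
  have "\<exists>z' \<in> ?T. z' \<in> neighbours ?G z" if "z \<in> vertices ?G" for z
  proof -
    consider v where "v \<in> vertices H" "z = POld v" | x where "x \<in> new_vertices H" "z = ?C x"
      using \<open>z \<in> vertices ?G\<close> unfolding V vertices_S2P by blast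
    then show ?thesis
    proof cases
      case 1
      then obtain x where "x \<in> half_edges_at H v" "x \<in> X" "PStem v (class_of x) \<noteq> f"
        using old_T by blast
      then show ?thesis
        using stem(1)[of x v] CV[of x] inT_class[of x] 1 by (auto simp: half_edges_at_def)
    next
      case 2
      show ?thesis
      proof (cases "base x \<in> W")
        case True
        then show ?thesis
          using stem(2)[OF 2(1) refl] class_stem[OF 2(1)] 2 OV[OF 2(1)]
          by (auto simp: inT_def intro!: bexI[of _ "POld (base x)"])
      next
        case False
        then obtain y where y: "y \<in> class_of x" "mate H y \<in> X" "PMid (parent_edge y) \<noteq> f"
          using class_T[OF 2(1)] by blast
        have "mate H y \<in> new_vertices H" using mate_in class_of_member(1)[OF 2(1) y(1)] by blast
        then show ?thesis
          using mid[OF 2(1) y(1,3)] CV inT_class y(2) 2(2) by blast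
      qed
    qed
  qed
  moreover have "\<exists>z' \<in> ?D. z' \<in> neighbours ?G z" if "z \<in> vertices ?G" "inT z" for z
  proof -
    consider v where "v \<in> vertices H" "z = POld v" | x where "x \<in> new_vertices H" "z = ?C x"
      using \<open>z \<in> vertices ?G\<close> unfolding V vertices_S2P by blast
    then show ?thesis
    proof cases
      case 1
      then have "v \<in> W" using that(2) by (simp add: inT_def)
      then obtain x where "x \<in> half_edges_at H v" "x \<notin> X" "PStem v (class_of x) \<noteq> f"
        using old_D by blast
      then show ?thesis
        using stem(1)[of x v] CV[of x] inT_class[of x] 1 by (auto simp: half_edges_at_def)
    next
      case 2
      then have x: "x \<in> X" using that(2) inT_class by simp
      show ?thesis
      proof (cases "base x \<in> W")
        case False
        then show ?thesis
          using stem(2)[OF 2(1) refl] class_stem[OF 2(1)] 2 x OV[OF 2(1)]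
          by (auto simp: inT_def intro!: bexI[of _ "POld (base x)"])
      next
        case True
        then obtain y where y: "y \<in> class_of x" "mate H y \<notin> X" "PMid (parent_edge y) \<noteq> f"
          using class_D[OF x 2(1)] by blast
        have "mate H y \<in> new_vertices H" using mate_in class_of_member(1)[OF 2(1) y(1)] by blast
        then show ?thesis
          using mid[OF 2(1) y(1,3)] CV inT_class y(2) 2(2) by blast
      qed
    qed
  qed
  ultimately have "DT_pair ?G ?D ?T"
    unfolding DT_pair_def dominating_def total_dominating_def by blast
  then show ?thesis unfolding DTDP_graph_def by blast
qed

lemma delete_edge_large_class:
  assumes x: "x \<in> new_vertices H" and large: "class_of x \<noteq> {x}"
    and deg: "half_edges_at H (base (mate H x)) \<noteq> {mate H x}"
  shows "\<exists>f \<in> edges (S2P H P). DTDP_graph (restrict_edges (S2P H P) (edges (S2P H P) - {f}))"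
proof -
  let ?m = "mate H x" and ?e = "parent_edge x"
  have m: "?m \<in> new_vertices H" using mate_in[OF x] .
  obtain x' where x': "x' \<in> class_of x" "x' \<noteq> x" using large class_of_in(2)[OF x] by blast
  show ?thesis
  proof (cases "class_of ?m = {?m}")
    case False
    then obtain m' where m': "m' \<in> class_of ?m" "m' \<noteq> ?m" using class_of_in(2)[OF m] by blast
    \<comment> \<open>Both classes on \<open>?e\<close> have another middle edge, since neither
      contains both halves of \<open>?e\<close>; so \<open>PMid ?e\<close> can go.\<close>
    have other: "\<exists>z \<in> class_of y. parent_edge z \<noteq> ?e" if y: "y \<in> new_vertices H" for y
    proof (cases "parent_edge y = ?e")
      case True
      then consider "y = x" | "y = ?m" using new_vertices_same_parent[OF x y] by metis
      then show ?thesis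
      proof cases
        case 1
        have "parent_edge x' \<noteq> ?e"
          using new_vertices_same_parent[OF x class_of_member(1)[OF x x'(1)]] x' mate_notin_class[OF x]
          by metis
        then show ?thesis using 1 x'(1) by blast
      next
        case 2
        have "parent_edge m' \<noteq> ?e"
          using new_vertices_same_parent[OF m class_of_member(1)[OF m m'(1)]] m' mate_notin_class[OF m]
            parent_edge_mate[OF x] by metis
        then show ?thesis using 2 m'(1) by blast
      qed
    next
      case False
      then show ?thesis using class_of_in(2)[OF y] by blast
    qed
    have "DTDP_graph (restrict_edges (S2P H P) (edges (S2P H P) - {PMid ?e}))"
      by (rule DTDP_delete_edge[where W = "{}" and X = UNIV])
        (use half_edges_at_nonempty other in auto)
    moreover have "PMid ?e \<in> edges (S2P H P)" using parent_edge_in[OF x] by (simp add: edges_S2P)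
    ultimately show ?thesis by blast
  next
    case True
    \<comment> \<open>The class \<open>{?m}\<close> moves to the dominating set and its stem is
      deleted. By \<open>deg\<close> the vertex \<open>?v\<close> has another class, and
      \<open>class_of x\<close> still reaches the total dominating set through
      \<open>x'\<close>.\<close>
    let ?v = "base ?m"
    have notm: "y \<noteq> ?m" if "class_of z = class_of x" "y \<in> class_of z" for y z
      using that mate_notin_class[OF x] by metis
    have mV: "?v \<in> vertices H" using base_in_vertices[OF multigraph m] .
    have "DTDP_graph (restrict_edges (S2P H P) (edges (S2P H P) - {PStem ?v (class_of ?m)}))"
    proof (rule DTDP_delete_edge[where W = "{}" and X = "- {?m}"])
      fix y z assume y: "y \<in> new_vertices H" "z \<in> class_of y"
      show "z \<in> - {?m} \<longleftrightarrow> y \<in> - {?m}"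
        using class_of_member[OF y] class_of_in(2)[OF y(1)] y(2) True by auto
    next
      fix v assume v: "v \<in> vertices H"
      have "\<exists>y \<in> half_edges_at H v. y \<noteq> ?m"
        using half_edges_at_nonempty[OF v] deg by (auto simp: half_edges_at_def)
      then obtain y where y: "y \<in> half_edges_at H v" "y \<noteq> ?m" by blast
      then have "class_of y \<noteq> class_of ?m"
        using class_of_in(2)[of y] True by (auto simp: half_edges_at_def)
      with y show "\<exists>y \<in> half_edges_at H v. y \<in> - {?m} \<and> PStem v (class_of y) \<noteq> PStem ?v (class_of ?m)"
        by blast
    next
      fix y assume y: "y \<in> new_vertices H" "y \<in> - {?m} \<or> base y \<in> {}"
      then show "PStem (base y) (class_of y) \<noteq> PStem ?v (class_of ?m)"
        using class_of_in(2)[OF y(1)] True by auto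
    next
      fix y assume y: "y \<in> new_vertices H"
      have "\<exists>z \<in> class_of y. mate H z \<noteq> ?m"
      proof (cases "mate H y = ?m")
        case eq: True
        then have "y = x" using mate_mate[OF x] mate_mate[OF y] by metis
        moreover have "mate H x' \<noteq> ?m"
          using mate_mate[OF x] mate_mate[OF class_of_member(1)[OF x x'(1)]] x'(2) by metis
        ultimately show ?thesis using x'(1) by blast
      next
        case False
        then show ?thesis using class_of_in(2)[OF y] by blast
      qed
      then show "\<exists>z \<in> class_of y. mate H z \<in> - {?m} \<and> PMid (parent_edge z) \<noteq> PStem ?v (class_of ?m)"
        by blast
    qed auto
    moreover have "PStem ?v (class_of ?m) \<in> edges (S2P H P)" using m by (auto simp: edges_S2P)
    ultimately show ?thesis by blast
  qed
qed

end

section \<open>Orientations\<close>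

text \<open>\<open>I\<close> stands for the head halves of the arcs, so
  \<open>mate H x \<in> I\<close> makes \<open>x\<close> a tail half. In \<open>step\<close>,
  \<open>x\<close> is the only outgoing half at \<open>v\<close> and all others are incoming; the
  arc with head half \<open>y\<close> starts at \<open>base (mate H y)\<close>.\<close>

inductive_set saturated :: "('v, 'e) mgraph \<Rightarrow> 'v set \<Rightarrow> ('v, 'e) sub_vertex set \<Rightarrow> 'v set"
  for H U I where
  start: "v \<in> U \<Longrightarrow> v \<in> saturated H U I"
| step: "half_edges_at H v - I = {x} \<Longrightarrow> mate H x \<in> I \<Longrightarrow> y \<in> half_edges_at H v \<Longrightarrow> y \<in> I \<Longrightarrow>
    base (mate H y) \<in> saturated H U I \<Longrightarrow> v \<in> saturated H U I"

context partitioned_graph begin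

text \<open>A good subgraph in terms of half-edges: \<open>U\<close> holds its vertices,
  \<open>K\<close> the halves of its edges, \<open>I\<close> the head halves of the arcs. The
  assumption \<open>large\<close> is the case left open by
  \<open>delete_edge_large_class\<close>.\<close>

lemma delete_edge_oriented:
  assumes I: "I \<subseteq> new_vertices H" "\<And>x. x \<in> I \<Longrightarrow> mate H x \<notin> I"
    and K: "K \<subseteq> new_vertices H" "\<And>x. x \<in> K \<Longrightarrow> mate H x \<in> K" "\<And>x. x \<in> K \<Longrightarrow> x \<notin> I"
      "\<And>x. x \<in> K \<Longrightarrow> base x \<in> U" "K \<noteq> {}"
    and at_U: "\<And>x. x \<in> new_vertices H \<Longrightarrow> base x \<in> U \<Longrightarrow> x \<in> K \<or> x \<in> I \<or> mate H x \<in> I"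
      "\<And>v. v \<in> U \<Longrightarrow> \<exists>x \<in> half_edges_at H v. x \<in> K"
      "\<And>v. v \<in> U \<Longrightarrow> \<exists>x \<in> half_edges_at H v. mate H x \<in> I"
    and out_unique: "\<And>v x y. v \<in> vertices H - U \<Longrightarrow> x \<in> half_edges_at H v \<Longrightarrow> y \<in> half_edges_at H v \<Longrightarrow>
      mate H x \<in> I \<Longrightarrow> mate H y \<in> I \<Longrightarrow> x = y"
    and out_in: "\<And>v x. v \<in> vertices H - U \<Longrightarrow> x \<in> half_edges_at H v \<Longrightarrow> mate H x \<in> I \<Longrightarrow>
      \<exists>y \<in> half_edges_at H v. y \<in> I"
    and not_all_in: "\<And>v. v \<in> vertices H \<Longrightarrow> \<exists>x \<in> half_edges_at H v. x \<notin> I"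
    and large: "\<And>x. x \<in> new_vertices H \<Longrightarrow> class_of x \<noteq> {x} \<Longrightarrow>
      half_edges_at H (base (mate H x)) = {mate H x}"
  shows "\<exists>f \<in> edges (S2P H P). DTDP_graph (restrict_edges (S2P H P) (edges (S2P H P) - {f}))"
proof -
  define W where "W = saturated H U I"
  define X where "X = {x \<in> new_vertices H. x \<notin> K \<and> \<not> (x \<in> I \<and> base (mate H x) \<in> W) \<and>
    \<not> (mate H x \<in> I \<and> base x \<notin> W \<and> base (mate H x) \<in> W)}"
  have U_W: "U \<subseteq> W" unfolding W_def by (auto intro: saturated.start)
  have W_cases: "v \<in> U \<or> (\<exists>x y. half_edges_at H v - I = {x} \<and> mate H x \<in> I \<and>
      y \<in> half_edges_at H v \<and> y \<in> I \<and> base (mate H y) \<in> W)" if "v \<in> W" for v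
    using that unfolding W_def by (cases rule: saturated.cases) blast+
  have at_base: "x \<in> half_edges_at H v \<longleftrightarrow> x \<in> new_vertices H \<and> base x = v" for x v
    by (simp add: half_edges_at_def)
  have W_types: "x \<in> K \<or> x \<in> I \<or> mate H x \<in> I" if "x \<in> new_vertices H" "base x \<in> W" for x
    using W_cases[OF that(2)]
  proof
    assume "\<exists>z y. half_edges_at H (base x) - I = {z} \<and> mate H z \<in> I \<and>
      y \<in> half_edges_at H (base x) \<and> y \<in> I \<and> base (mate H y) \<in> W"
    then obtain z where z: "half_edges_at H (base x) - I = {z}" "mate H z \<in> I" by blast
    have "x \<in> I \<or> x \<in> half_edges_at H (base x) - I" using that(1) at_base by simp
    then show ?thesis using z(2) unfolding z(1) by auto
  qed (rule at_U(1)[OF that(1)])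
  \<comment> \<open>Otherwise \<open>mate H x\<close> is the only half at its base. The base is not
    in \<open>U\<close>, where a half in \<open>K\<close> and a tail half are both present. A lone
    half cannot be a head by \<open>not_all_in\<close>, nor a tail by \<open>out_in\<close>.\<close>
  have singleton: "class_of x = {x}" if x: "x \<in> new_vertices H" "x \<in> K \<or> x \<in> I \<or> mate H x \<in> I" for x
  proof (rule ccontr)
    assume "class_of x \<noteq> {x}"
    then have only: "half_edges_at H (base (mate H x)) = {mate H x}" by (rule large[OF x(1)])
    have m: "mate H x \<in> new_vertices H" using mate_in[OF x(1)] .
    have v: "base (mate H x) \<in> vertices H" using base_in_vertices[OF multigraph m] .
    have mm: "mate H (mate H x) = x" using mate_mate[OF x(1)] .
    have notU: "base (mate H x) \<notin> U"
    proof
      assume u: "base (mate H x) \<in> U"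
      then have "mate H x \<in> K" "mate H (mate H x) \<in> I" using at_U(2,3)[OF u] unfolding only by simp_all
      then show False using K(2,3) by blast
    qed
    have "mate H x \<notin> I" using not_all_in[OF v] unfolding only by simp
    moreover have "x \<notin> K" using K(2,4) notU by blast
    ultimately have "x \<in> I" using x(2) by blast
    then have "mate H x \<in> I" using out_in[of "base (mate H x)" "mate H x"] v notU only mm by auto
    with \<open>mate H x \<notin> I\<close> show False ..
  qed
  \<comment> \<open>Hence larger classes avoid all three exclusions in \<open>X\<close>, and
    membership in \<open>X\<close> is constant on classes.\<close>
  have free_X: "y \<in> X" if "x \<in> new_vertices H" "class_of x \<noteq> {x}" "y \<in> class_of x" for x y
  proof -
    note y = class_of_member[OF that(1,3)]
    have "class_of y \<noteq> {y}" using that y(3) class_of_in(2)[OF that(1)] by auto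
    then show ?thesis using singleton[OF y(1)] y(1) unfolding X_def by blast
  qed
  have X: "y \<in> X \<longleftrightarrow> x \<in> X" if "x \<in> new_vertices H" "y \<in> class_of x" for x y
  proof (cases "class_of x = {x}")
    case True
    then show ?thesis using that(2) by simp
  next
    case False
    then show ?thesis using free_X[OF that(1) False] class_of_in(2)[OF that(1)] that(2) by blast
  qed
  \<comment> \<open>Both halves of the edge of \<open>q\<close> are in \<open>K\<close>, so both
    their classes are dominating vertices, and their bases in \<open>U \<subseteq> W\<close> already
    totally dominate them. The middle edge between them is the one to delete.\<close>
  obtain q where q: "q \<in> K" using K(5) by blast
  have qN: "q \<in> new_vertices H" using q K(1) by blast
  have not_q: "parent_edge x \<noteq> parent_edge q" if "x \<in> new_vertices H" "x \<notin> K" for x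
    using new_vertices_same_parent[OF qN that(1)] q K(2)[OF q] that(2) by metis
  have "DTDP_graph (restrict_edges (S2P H P) (edges (S2P H P) - {PMid (parent_edge q)}))"
  proof (rule DTDP_delete_edge[where W = W and X = X, OF X])
    fix v assume v: "v \<in> vertices H"
    have "\<exists>x \<in> half_edges_at H v. x \<in> X"
    proof (cases "v \<in> W")
      case True
      \<comment> \<open>Every vertex of \<open>W\<close> has an outgoing arc; its tail half stays in
        \<open>X\<close> because \<open>v\<close> itself is in \<open>W\<close>.\<close>
      then obtain x where x: "x \<in> half_edges_at H v" "mate H x \<in> I"
        using W_cases[OF True] at_U(3) by blast
      then have "x \<notin> I" "x \<notin> K" using I(2)[of x] K(2)[of x] K(3)[of "mate H x"] by blast+
      then have "x \<in> X" using x True at_base[of x v] unfolding X_def by simp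
      then show ?thesis using x(1) by blast
    next
      case False
      then have vU: "v \<in> vertices H - U" using v U_W by blast
      show ?thesis
      proof (rule ccontr)
        \<comment> \<open>Then all halves at \<open>v\<close> belong to arcs and the incoming ones
          start in \<open>W\<close>. There is exactly one outgoing arc and, by
          \<open>out_in\<close>, an incoming one, so \<open>saturated.step\<close> puts
          \<open>v\<close> into \<open>W\<close>.\<close>
        assume none: "\<not> ?thesis"
        have D: "x \<in> I \<and> base (mate H x) \<in> W \<or> mate H x \<in> I" if "x \<in> half_edges_at H v" for x
        proof -
          have "x \<notin> X" "x \<in> new_vertices H" "base x = v" using none that at_base by blast+
          then show ?thesis using K(4)[of x] vU unfolding X_def by auto
        qed
        obtain x where x: "x \<in> half_edges_at H v" "x \<notin> I" using not_all_in[OF v] by blast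
        then have mx: "mate H x \<in> I" using D by blast
        then obtain y where y: "y \<in> half_edges_at H v" "y \<in> I" using out_in[OF vU x(1)] by blast
        then have "base (mate H y) \<in> W" using D[of y] I(2)[of y] by blast
        moreover have "half_edges_at H v - I = {x}"
        proof
          show "half_edges_at H v - I \<subseteq> {x}"
            using D out_unique[OF vU _ x(1) _ mx] by blast
        qed (use x in blast)
        ultimately have "v \<in> W" using mx y saturated.step unfolding W_def by metis
        with False show False ..
      qed
    qed
    then show "\<exists>x \<in> half_edges_at H v. x \<in> X \<and> PStem v (class_of x) \<noteq> PMid (parent_edge q)"
      by blast
  next
    fix v assume v: "v \<in> W"
    have "\<exists>x \<in> half_edges_at H v. x \<notin> X"
      using W_cases[OF v] at_U(2) unfolding X_def by blast
    then show "\<exists>x \<in> half_edges_at H v. x \<notin> X \<and> PStem v (class_of x) \<noteq> PMid (parent_edge q)"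
      by blast
  next
    fix x assume x: "x \<in> X" "x \<in> new_vertices H" "base x \<in> W"
    have "x \<notin> K" using x(1) unfolding X_def by simp
    \<comment> \<open>If \<open>x\<close> is a tail, its mate is the head of an arc from
      \<open>W\<close>. If \<open>x\<close> is a head, \<open>x \<in> X\<close> forces the arc to
      start outside \<open>W\<close>, and the mate is the tail of an arc that only ends in
      \<open>W\<close>.\<close>
    moreover from this have "mate H x \<notin> X"
      using W_types[OF x(2,3)] x mate_mate[OF x(2)] unfolding X_def by auto
    ultimately show "\<exists>y \<in> class_of x. mate H y \<notin> X \<and> PMid (parent_edge y) \<noteq> PMid (parent_edge q)"
      using class_of_in(2)[OF x(2)] not_q[OF x(2)] by blast
  next
    fix x assume x: "x \<in> new_vertices H" "base x \<notin> W"
    have "x \<notin> K" using x(2) K(4) U_W by blast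
    moreover from this have "mate H x \<notin> K" using K(2) mate_mate[OF x(1)] by metis
    \<comment> \<open>Both arc exclusions for \<open>mate H x\<close> would require
      \<open>base x \<in> W\<close>.\<close>
    then have "mate H x \<in> X" using x mate_mate[OF x(1)] mate_in[OF x(1)] unfolding X_def by simp
    ultimately show "\<exists>y \<in> class_of x. mate H y \<in> X \<and> PMid (parent_edge y) \<noteq> PMid (parent_edge q)"
      using class_of_in(2)[OF x(1)] not_q[OF x(1)] by blast
  qed simp_all
  moreover have "PMid (parent_edge q) \<in> edges (S2P H P)"
    using parent_edge_in[OF qN] by (simp add: edges_S2P)
  ultimately show ?thesis by blast
qed

end

section \<open>Good subgraphs\<close>

text \<open>Such an arc is not the first one, and the arc before it in \<open>p\<close> enters its
  tail. This yields an incoming arc at each vertex outside \<open>Q\<close> that has an outgoing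
  one.\<close>

lemma cas_predecessor:
  assumes "pre_digraph.cas A u p v" "e \<in> set p" "tail A e \<noteq> u"
  shows "\<exists>e' \<in> set p. head A e' = tail A e"
  using assms
proof (induction p arbitrary: u)
  case (Cons a p)
  then show ?case
    by (cases "tail A e = head A a") (auto simp: pre_digraph.cas.simps)
qed simp

lemma dipath_fromD:
  assumes "dipath_from A w p"
  shows "p \<noteq> []" "set p \<subseteq> arcs A" "\<exists>v. pre_digraph.cas A w p v"
  using assms unfolding dipath_from_def pre_digraph.apath_def pre_digraph.awalk_def by blast+

context partitioned_graph begin

text \<open>If \<open>delete_edge_large_class\<close> does not apply, the conditions on paths and
  degrees are translated into the half-edge conditions of
  \<open>delete_edge_oriented\<close>.\<close>

lemma delete_edge_good_subgraph:
  assumes "good_subgraph H Q"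
  shows "\<exists>f \<in> edges (S2P H P). DTDP_graph (restrict_edges (S2P H P) (edges (S2P H P) - {f}))"
proof (cases "\<forall>x \<in> new_vertices H. class_of x \<noteq> {x} \<longrightarrow> half_edges_at H (base (mate H x)) = {mate H x}")
  case False
  then show ?thesis using delete_edge_large_class by blast
next
  case True
  let ?N = "new_vertices H" and ?U = "vertices Q"
  have Q: "mg_subgraph Q H" "?U \<noteq> {}" "no_isolated_vertex Q"
    using assms by (simp_all add: good_subgraph_def)
  obtain E A F where E: "boundary_edges H Q \<subseteq> E" "E \<subseteq> edges H - edges Q" and A: "orients H E A"
    and F: "(\<Union>w \<in> ?U. arcs (F w)) = arcs A" "\<And>w. w \<in> ?U \<Longrightarrow> union_of_dipaths_from A w (F w)"
    and out: "\<And>x. x \<in> vertices H - ?U \<Longrightarrow> out_degree A x \<le> 1"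
    and inn: "\<And>x. x \<in> vertices H \<Longrightarrow> in_degree A x < degree H x"
    using assms unfolding good_subgraph_def
    by (elim conjE exE) (rule that; (assumption | erule (1) bspec))
  have arcs: "arcs A = E" and orient: "\<And>e. e \<in> E \<Longrightarrow> Upair (tail A e) (head A e) = ends H e"
    using A by (simp_all add: orients_def)
  have ends: "ends H e = Upair (head A e) (tail A e)" if "e \<in> E" for e
    unfolding orient[OF that, symmetric] by simp
  have finE: "finite E" using E(2) multigraph by (auto simp: multigraph_def intro: finite_subset)
  have QH: "edges Q \<subseteq> edges H" "\<And>e. e \<in> edges Q \<Longrightarrow> ends Q e = ends H e"
    "\<And>e. e \<in> edges Q \<Longrightarrow> set_uprod (ends Q e) \<subseteq> ?U"
    using Q(1) unfolding mg_subgraph_def multigraph_def by blast+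
  \<comment> \<open>\<open>h e\<close> will be the half at the head of the arc \<open>e\<close>; on
    a loop either half may serve.\<close>
  have "\<forall>e \<in> E. \<exists>x. x \<in> ?N \<and> parent_edge x = e \<and> base x = head A e \<and> base (mate H x) = tail A e"
    using ex_new_vertex ends E(2) by (metis DiffD1 subsetD)
  then obtain h where h: "\<And>e. e \<in> E \<Longrightarrow> h e \<in> ?N" "\<And>e. e \<in> E \<Longrightarrow> parent_edge (h e) = e"
    "\<And>e. e \<in> E \<Longrightarrow> base (h e) = head A e" "\<And>e. e \<in> E \<Longrightarrow> base (mate H (h e)) = tail A e"
    using bchoice[of E "\<lambda>e x. x \<in> ?N \<and> parent_edge x = e \<and> base x = head A e \<and> base (mate H x) = tail A e"]
    by auto
  define K where "K = {x \<in> ?N. parent_edge x \<in> edges Q}"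
  have at_base: "x \<in> half_edges_at H v \<longleftrightarrow> x \<in> ?N \<and> base x = v" for x v
    by (simp add: half_edges_at_def)
  have K_at: "\<exists>x \<in> half_edges_at H v. x \<in> K" if v: "v \<in> ?U" for v
  proof -
    have "degree Q v \<noteq> 0" using Q(3) v by (simp add: no_isolated_vertex_def)
    then have "\<exists>e \<in> edges Q. v \<in> set_uprod (ends Q e)"
      unfolding degree_def by (metis (mono_tags, lifting) add_is_0 card.empty empty_Collect_eq insertI1 set_uprod_simps)
    then obtain e where e: "e \<in> edges Q" "v \<in> set_uprod (ends H e)" using QH(2) by auto
    obtain a b where "ends H e = Upair a b" by (cases "ends H e")
    then have "ends H e = Upair v (if v = a then b else a)" using e(2) by auto
    then obtain x where "x \<in> ?N" "parent_edge x = e" "base x = v"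
      by (rule ex_new_vertex[OF subsetD[OF QH(1) e(1)]])
    then show ?thesis using e(1) by (auto simp: K_def half_edges_at_def)
  qed
  have tail_mate: "\<exists>e \<in> E. mate H x = h e \<and> x = mate H (h e) \<and> tail A e = base x"
    if x: "x \<in> ?N" "mate H x \<in> h ` E" for x
  proof -
    obtain e where e: "e \<in> E" "mate H x = h e" using x(2) by blast
    then have m: "x = mate H (h e)" using mate_mate[OF x(1)] by simp
    then have "tail A e = base x" using h(4)[OF e(1)] by simp
    with e m show ?thesis by (intro bexI[of _ e] conjI)
  qed
  have dipath: "\<exists>p. dipath_from A w p \<and> set p \<subseteq> E \<and> e \<in> set p"
    if w: "w \<in> ?U" "e \<in> arcs (F w)" for w e
  proof -
    obtain ps where ps: "\<forall>p \<in> ps. dipath_from A w p" "arcs (F w) = (\<Union>p \<in> ps. set p)"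
      using F(2)[OF w(1)] unfolding union_of_dipaths_from_def by (elim conjE exE) (rule that)
    then obtain p where p: "p \<in> ps" "e \<in> set p" using w(2) by auto
    then have "dipath_from A w p" using ps(1) by simp
    moreover from this have "set p \<subseteq> E" using dipath_fromD(2) arcs by metis
    ultimately show ?thesis using p(2) by blast
  qed
  show ?thesis
  proof (rule delete_edge_oriented[where U = ?U and I = "h ` E" and K = K])
    show "h ` E \<subseteq> ?N" "K \<subseteq> ?N" using h(1) by (auto simp: K_def)
    show "K \<noteq> {}" using K_at Q(2) by blast
    show "mate H x \<notin> h ` E" if "x \<in> h ` E" for x
    proof
      \<comment> \<open>Mates have the same parent edge, and \<open>h\<close> selects only one half
        of each edge.\<close>
      assume "mate H x \<in> h ` E"
      then have "mate H x = x" using that h(1,2) parent_edge_mate by (metis imageE)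
      then show False using mate_neq that h(1) by blast
    qed
    show "mate H x \<in> K" if "x \<in> K" for x
      using that mate_in parent_edge_mate unfolding K_def by fastforce
    show "x \<notin> h ` E" if "x \<in> K" for x
      using that h(2) E(2) unfolding K_def by auto
    show "base x \<in> ?U" if "x \<in> K" for x
      using that ends_mate[of x H] QH(2,3)[of "parent_edge x"] unfolding K_def by auto
    show "x \<in> K \<or> x \<in> h ` E \<or> mate H x \<in> h ` E" if x: "x \<in> ?N" "base x \<in> ?U" for x
    proof (cases "parent_edge x \<in> edges Q")
      case False
      then have "parent_edge x \<in> boundary_edges H Q"
        using x parent_edge_in[OF x(1)] ends_mate[OF x(1)] by (simp add: boundary_edges_def)
      then have e: "parent_edge x \<in> E" using E(1) by blast
      have "h (parent_edge x) = x \<or> h (parent_edge x) = mate H x"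
        by (rule new_vertices_same_parent) (use x h(1,2)[OF e] in simp_all)
      then show ?thesis using e by (metis imageI)
    qed (use x in \<open>simp add: K_def\<close>)
    show "\<exists>x \<in> half_edges_at H v. x \<in> K" if "v \<in> ?U" for v using K_at that .
    show "\<exists>x \<in> half_edges_at H v. mate H x \<in> h ` E" if v: "v \<in> ?U" for v
    proof -
      obtain ps where "ps \<noteq> {}" "\<forall>p \<in> ps. dipath_from A v p"
        using F(2)[OF v] unfolding union_of_dipaths_from_def by (elim conjE exE) (rule that)
      then obtain p where p: "dipath_from A v p" by blast
      \<comment> \<open>Path families are non-empty, and the first arc of a path from
        \<open>v\<close> leaves \<open>v\<close>.\<close>
      note D = dipath_fromD[OF p]
      have e: "hd p \<in> E" "tail A (hd p) = v"
        using D arcs by (auto simp: pre_digraph.cas_simp)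
      have "mate H (h (hd p)) \<in> half_edges_at H v" "mate H (mate H (h (hd p))) = h (hd p)"
        using h(1,4)[OF e(1)] e(2) mate_in mate_mate unfolding at_base by auto
      then show ?thesis using e(1) by (metis imageI)
    qed
    show "x = y" if v: "v \<in> vertices H - ?U" and xy: "x \<in> half_edges_at H v" "y \<in> half_edges_at H v"
      "mate H x \<in> h ` E" "mate H y \<in> h ` E" for v x y
    proof -
      obtain a b where ab: "a \<in> E" "x = mate H (h a)" "tail A a = v"
        "b \<in> E" "y = mate H (h b)" "tail A b = v"
        using tail_mate xy unfolding at_base by metis
      have "{a, b} \<subseteq> out_arcs A v" using ab arcs by simp
      moreover have "finite (out_arcs A v)" using finE arcs by (simp add: out_arcs_def)
      ultimately have "card {a, b} \<le> 1" using out[OF v] unfolding out_degree_def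
        by (meson card_mono le_trans)
      then show ?thesis using ab by (cases "a = b") auto
    qed
    show "\<exists>y \<in> half_edges_at H v. y \<in> h ` E"
      if v: "v \<in> vertices H - ?U" and x: "x \<in> half_edges_at H v" "mate H x \<in> h ` E" for v x
    proof -
      obtain e where e: "e \<in> E" "tail A e = v" using tail_mate x unfolding at_base by metis
      \<comment> \<open>The arc \<open>e\<close> lies on a path from a vertex \<open>w\<close> of
        \<open>Q\<close>. As \<open>v\<close> is outside \<open>Q\<close>, it differs from
        \<open>w\<close>, so the path enters \<open>v\<close> before using \<open>e\<close>.\<close>
      obtain w where w: "w \<in> ?U" "e \<in> arcs (F w)" using F(1) e(1) arcs by blast
      obtain p where p: "dipath_from A w p" "set p \<subseteq> E" "e \<in> set p" using dipath[OF w] by blast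
      obtain u where "pre_digraph.cas A w p u" using dipath_fromD(3)[OF p(1)] by blast
      then obtain e' where "e' \<in> E" "head A e' = v"
        using cas_predecessor[of A w p u e] p e(2) w(1) v by blast
      then show ?thesis using h(1,3)[of e'] by (intro bexI[of _ "h e'"]) (auto simp: at_base)
    qed
    show "\<exists>x \<in> half_edges_at H v. x \<notin> h ` E" if v: "v \<in> vertices H" for v
    proof (rule ccontr)
      assume "\<not> ?thesis"
      \<comment> \<open>Then \<open>h\<close> would map the arcs into \<open>v\<close> onto all
        half-edges there, making the in-degree at least the degree.\<close>
      then have "half_edges_at H v \<subseteq> h ` in_arcs A v"
        using h(3) arcs by (auto simp: at_base)
      moreover have "finite (in_arcs A v)" using finE arcs by (simp add: in_arcs_def)
      ultimately have "card (half_edges_at H v) \<le> in_degree A v"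
        unfolding in_degree_def by (rule surj_card_le[rotated])
      then show False using inn[OF v] degree_eq_card_half_edges_at[OF multigraph, of v] by simp
    qed
  qed (use True in blast)
qed

end

section \<open>Passing from one deletable edge to all leaf multiplicities\<close>

theorem theorem4p5:
  fixes H :: "('v, 'e) mgraph"
    and P :: "'v \<Rightarrow> ('v, 'e) sub_vertex set set"
  assumes "multigraph H" and "connected_graph H" and "no_isolated_vertex H"
    and "\<forall>v \<in> vertices H. partition_on (neighbours (S2 H) (Old v)) (P v)"
    and "\<forall>e \<in> edges H. \<forall>v. ends H e = Upair v v \<longrightarrow>
           \<not> (\<exists>A \<in> P v. NewL1 v e \<in> A \<and> NewL2 v e \<in> A)"
    and "\<exists>Q. good_subgraph H Q"
  shows "\<forall>\<theta> :: ('v, 'e) part_vertex \<Rightarrow> nat. (\<forall>x. is_leaf (S2P H P) x \<longrightarrow> 0 < \<theta> x) \<longrightarrow>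
           DTDP_graph (S2P_theta H P \<theta>) \<and> \<not> minimal_DTDP_graph (S2P_theta H P \<theta>)"
proof (intro allI impI)
  fix \<theta> :: "('v, 'e) part_vertex \<Rightarrow> nat"
  assume pos: "\<forall>x. is_leaf (S2P H P) x \<longrightarrow> 0 < \<theta> x"
  interpret partitioned_graph H P
    by unfold_locales (use assms in blast)+
  obtain f where f: "f \<in> edges (S2P H P)"
    "DTDP_graph (restrict_edges (S2P H P) (edges (S2P H P) - {f}))"
    using delete_edge_good_subgraph assms(6) by blast
  show "DTDP_graph (S2P_theta H P \<theta>) \<and> \<not> minimal_DTDP_graph (S2P_theta H P \<theta>)"
    unfolding S2P_theta_def
    by (rule multiply_leaves_not_minimal[OF multigraph_S2P _ f(2)])
      (use f(1) pos leaves_not_adjacent in blast)+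
qed

end
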